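(* Let $D\ge2$, and let MOO ("Move Only Outwards") be any lazy and local deterministic online algorithm for the infinite server problem on layered graphs that moves servers along edges only in the direction away from the source. Then the competitive ratio of MOO on layered graphs of depth $D$ is exactly $D-\frac12$: on every layered graph of depth $D$ it is $(D-\frac12)$-competitive, and for every $\rho<D-\frac12$ there is a layered graph of depth $D$ on which it is not $\rho$-competitive.
   Context: A layered graph of depth $D$ is a graph whose (possibly infinitely many) nodes are arranged in layers $0,1,\dots,D$ such that all edges run between adjacent layers, layer $0$ consists of a single node, and every node other than that one is adjacent to at least one node of the previous layer. Its metric is the shortest-path (number of edges) distance; the single node of layer $0$ is the source. Infinite server problem: an unbounded number of servers initially reside at the source; a finite sequence of requests (nodes) is revealed one by one; each must be served immediately, without knowledge of future requests, by moving a server to it; the cost is the total distance traveled. An algorithm is lazy if it moves only one server to serve a request at an unoccupied point and moves no server if the requested point is already occupied. It is local if it moves a server from $a$ to $b$ only when there is no server at some other point $c$ with $d(a,b)=d(a,c)+d(c,b)$. An online algorithm is $\rho$-competitive if $ALG(\sigma)\le\rho\,OPT(\sigma)+c$ for all $\sigma$, with $c$ independent of $\sigma$; its competitive ratio is the infimum of such $\rho$. *)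

theory Defs
  imports Complex_Main
begin

record 'v lgraph =
  verts :: "'v set"
  adj   :: "'v \<Rightarrow> 'v \<Rightarrow> bool"
  layer :: "'v \<Rightarrow> nat"
  src   :: 'v

definition layered_graph :: "'v lgraph \<Rightarrow> nat \<Rightarrow> bool" where
  "layered_graph G D \<longleftrightarrow>
     (\<forall>u v. adj G u v \<longrightarrow> u \<in> verts G \<and> v \<in> verts G) \<and>
     (\<forall>u v. adj G u v \<longrightarrow> adj G v u) \<and>
     (\<forall>u v. adj G u v \<longrightarrow> layer G v = Suc (layer G u) \<or> layer G u = Suc (layer G v)) \<and>
     (\<forall>v\<in>verts G. layer G v \<le> D) \<and>
     (\<exists>v\<in>verts G. layer G v = D) \<and>
     src G \<in> verts G \<and> layer G (src G) = 0 \<and>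
     (\<forall>v\<in>verts G. layer G v = 0 \<longrightarrow> v = src G) \<and>
     (\<forall>v\<in>verts G. 0 < layer G v \<longrightarrow> (\<exists>u. adj G u v \<and> Suc (layer G u) = layer G v))"

inductive gwalk :: "('v \<Rightarrow> 'v \<Rightarrow> bool) \<Rightarrow> 'v \<Rightarrow> 'v \<Rightarrow> nat \<Rightarrow> bool" for E where
  gwalk_nil: "gwalk E u u 0"
| gwalk_step: "E u w \<Longrightarrow> gwalk E w v n \<Longrightarrow> gwalk E u v (Suc n)"

definition gdist :: "'v lgraph \<Rightarrow> 'v \<Rightarrow> 'v \<Rightarrow> nat" where
  "gdist G u v = (LEAST n. gwalk (adj G) u v n)"

inductive outwalk :: "'v lgraph \<Rightarrow> 'v \<Rightarrow> 'v \<Rightarrow> nat \<Rightarrow> bool" for G where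
  outwalk_nil: "outwalk G u u 0"
| outwalk_step: "adj G u w \<Longrightarrow> layer G w = Suc (layer G u) \<Longrightarrow> outwalk G w v n
                 \<Longrightarrow> outwalk G u v (Suc n)"

text \<open>A configuration records the number of servers at each node other than the
  source; the source always holds (unboundedly many) servers.  A move (a,b)
  moves a single server from a to b.\<close>

definition occ :: "'v lgraph \<Rightarrow> ('v \<Rightarrow> nat) \<Rightarrow> 'v \<Rightarrow> bool" where
  "occ G c x \<longleftrightarrow> x = src G \<or> 0 < c x"

definition mv :: "'v lgraph \<Rightarrow> ('v \<Rightarrow> nat) \<Rightarrow> 'v \<times> 'v \<Rightarrow> ('v \<Rightarrow> nat)" where
  "mv G c m = (let a = fst m; b = snd m;
                   c1 = (if a = src G then c else c(a := c a - 1))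
               in if b = src G then c1 else c1(b := Suc (c1 b)))"

definition apply_moves :: "'v lgraph \<Rightarrow> ('v \<Rightarrow> nat) \<Rightarrow> ('v \<times> 'v) list \<Rightarrow> ('v \<Rightarrow> nat)" where
  "apply_moves G c ms = foldl (mv G) c ms"

fun valid_moves :: "'v lgraph \<Rightarrow> ('v \<Rightarrow> nat) \<Rightarrow> ('v \<times> 'v) list \<Rightarrow> bool" where
  "valid_moves G c [] = True"
| "valid_moves G c (m # ms) =
     (fst m \<in> verts G \<and> snd m \<in> verts G \<and> occ G c (fst m) \<and> valid_moves G (mv G c m) ms)"

fun sched_ok :: "'v lgraph \<Rightarrow> ('v \<Rightarrow> nat) \<Rightarrow> 'v list \<Rightarrow> ('v \<times> 'v) list list \<Rightarrow> bool" where
  "sched_ok G c [] [] = True"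
| "sched_ok G c (r # rs) (ms # mss) =
     (valid_moves G c ms \<and> occ G (apply_moves G c ms) r \<and>
      sched_ok G (apply_moves G c ms) rs mss)"
| "sched_ok G c _ _ = False"

definition init_conf :: "'v \<Rightarrow> nat" where
  "init_conf = (\<lambda>_. 0)"

definition sched_cost :: "'v lgraph \<Rightarrow> ('v \<times> 'v) list list \<Rightarrow> nat" where
  "sched_cost G M = (\<Sum>m\<leftarrow>concat M. gdist G (fst m) (snd m))"

definition opt_cost :: "'v lgraph \<Rightarrow> 'v list \<Rightarrow> nat" where
  "opt_cost G \<sigma> = (LEAST n. \<exists>M. sched_ok G init_conf \<sigma> M \<and> sched_cost G M = n)"

text \<open>A deterministic online algorithm (for all layered graphs) maps the graph and the
  sequence of requests revealed so far (the last one being the current request) to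
  the list of moves it performs to serve the current request.\<close>
type_synonym 'v online_alg = "'v lgraph \<Rightarrow> 'v list \<Rightarrow> ('v \<times> 'v) list"

definition alg_sched :: "'v online_alg \<Rightarrow> 'v lgraph \<Rightarrow> 'v list \<Rightarrow> ('v \<times> 'v) list list" where
  "alg_sched A G \<sigma> = map (\<lambda>i. A G (take (Suc i) \<sigma>)) [0..<length \<sigma>]"

definition alg_conf :: "'v online_alg \<Rightarrow> 'v lgraph \<Rightarrow> 'v list \<Rightarrow> ('v \<Rightarrow> nat)" where
  "alg_conf A G \<sigma> = foldl (apply_moves G) init_conf (alg_sched A G \<sigma>)"

definition alg_cost :: "'v online_alg \<Rightarrow> 'v lgraph \<Rightarrow> 'v list \<Rightarrow> nat" where
  "alg_cost A G \<sigma> = sched_cost G (alg_sched A G \<sigma>)"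

definition serves_all :: "'v online_alg \<Rightarrow> 'v lgraph \<Rightarrow> bool" where
  "serves_all A G \<longleftrightarrow> (\<forall>\<sigma>. set \<sigma> \<subseteq> verts G \<longrightarrow> sched_ok G init_conf \<sigma> (alg_sched A G \<sigma>))"

definition is_lazy :: "'v online_alg \<Rightarrow> 'v lgraph \<Rightarrow> bool" where
  "is_lazy A G \<longleftrightarrow> (\<forall>\<sigma> r. set (\<sigma> @ [r]) \<subseteq> verts G \<longrightarrow>
      (if occ G (alg_conf A G \<sigma>) r then A G (\<sigma> @ [r]) = [] else length (A G (\<sigma> @ [r])) = 1))"

definition local_move :: "'v lgraph \<Rightarrow> ('v \<Rightarrow> nat) \<Rightarrow> 'v \<times> 'v \<Rightarrow> bool" where
  "local_move G c m \<longleftrightarrow> (\<forall>x\<in>verts G. x \<noteq> fst m \<and> x \<noteq> snd m \<and> occ G c x \<longrightarrow>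
      gdist G (fst m) (snd m) \<noteq> gdist G (fst m) x + gdist G x (snd m))"

fun local_moves :: "'v lgraph \<Rightarrow> ('v \<Rightarrow> nat) \<Rightarrow> ('v \<times> 'v) list \<Rightarrow> bool" where
  "local_moves G c [] = True"
| "local_moves G c (m # ms) = (local_move G c m \<and> local_moves G (mv G c m) ms)"

definition is_local :: "'v online_alg \<Rightarrow> 'v lgraph \<Rightarrow> bool" where
  "is_local A G \<longleftrightarrow> (\<forall>\<sigma> r. set (\<sigma> @ [r]) \<subseteq> verts G \<longrightarrow>
      local_moves G (alg_conf A G \<sigma>) (A G (\<sigma> @ [r])))"

definition moves_outwards :: "'v online_alg \<Rightarrow> 'v lgraph \<Rightarrow> bool" where
  "moves_outwards A G \<longleftrightarrow> (\<forall>\<sigma>. set \<sigma> \<subseteq> verts G \<longrightarrow> \<sigma> \<noteq> [] \<longrightarrow>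
      (\<forall>m\<in>set (A G \<sigma>). outwalk G (fst m) (snd m) (gdist G (fst m) (snd m))))"

definition competitive :: "'v online_alg \<Rightarrow> 'v lgraph \<Rightarrow> real \<Rightarrow> bool" where
  "competitive A G \<rho> \<longleftrightarrow> (\<exists>c::real. \<forall>\<sigma>. set \<sigma> \<subseteq> verts G \<longrightarrow>
      real (alg_cost A G \<sigma>) \<le> \<rho> * real (opt_cost G \<sigma>) + c)"

end

(*
  Upper bound: an outward-moving server at layer l has paid l in total.  For an online
  configuration s and an offline configuration c consider the potential that charges weight(l)
  for every offline server at layer l, and l for every node of layer l that is occupied offline
  but not online, where weight(0) = 0 and weight(l) = D - 1 - l/2 for l > 0.  An offline step
  along an edge raises it by at most D - 1/2.  An online move from a to the requested node r
  pays layer r - layer a, which is exactly what the second part of the potential releases.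
  The condition D >= 2 gives weight(D) >= 0, so the potential is nonnegative.

  Lower bound: the graph is a path from the source to layer D - 2, whose end is joined to infinitely
  many nodes B j of layer D - 1; the node R x t of layer D is joined to B x, B t and B (t+1).
  Both players occupy B x and B t.  On a request to R x t the online player must vacate one
  of these two nodes, by locality, while the offline player uses the server at the other one.
  The vacated node is requested next, and then B (t+1), which the offline player serves from R x t.
  Such a round costs 2 offline and 1 + 2(D - 1) = 2D - 1 online, and can be repeated.
*)
theory Submission
  imports Defs "HOL-Library.Countable"
begin

section \<open>Distances in layered graphs\<close>

lemma gwalk_append: "gwalk E u v m \<Longrightarrow> gwalk E v w n \<Longrightarrow> gwalk E u w (m + n)"
  by (induction rule: gwalk.induct) (auto intro: gwalk.intros)

lemma gwalk_sym:
  assumes "\<And>u v. E u v \<Longrightarrow> E v u"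
  shows "gwalk E u v n \<Longrightarrow> gwalk E v u n"
proof (induction rule: gwalk.induct)
  case (gwalk_step u w v n)
  then show ?case
    using gwalk_append[of E v w n u 1] assms gwalk.intros[of E] by fastforce
qed (rule gwalk_nil)

lemma gdist_le: "gwalk (adj G) u v n \<Longrightarrow> gdist G u v \<le> n"
  unfolding gdist_def by (rule Least_le)

lemma outwalk_layer: "outwalk G u v n \<Longrightarrow> layer G v = layer G u + n"
  by (induction rule: outwalk.induct) auto

locale layered =
  fixes G :: "'v lgraph" and D :: nat
  assumes layered: "layered_graph G D"
begin

lemma adj_sym: "adj G u v \<Longrightarrow> adj G v u"
  and adj_verts: "adj G u v \<Longrightarrow> u \<in> verts G \<and> v \<in> verts G"
  and adj_layer: "adj G u v \<Longrightarrow> layer G v = Suc (layer G u) \<or> layer G u = Suc (layer G v)"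
  and layer_le: "v \<in> verts G \<Longrightarrow> layer G v \<le> D"
  and layer_src: "layer G (src G) = 0"
  and src_verts: "src G \<in> verts G"
  and layer_0: "v \<in> verts G \<Longrightarrow> layer G v = 0 \<Longrightarrow> v = src G"
  and pred_ex: "v \<in> verts G \<Longrightarrow> 0 < layer G v \<Longrightarrow> \<exists>u. adj G u v \<and> Suc (layer G u) = layer G v"
  using layered unfolding layered_graph_def by blast+

lemma walk_layer: "gwalk (adj G) u v n \<Longrightarrow> layer G v \<le> layer G u + n"
  by (induction rule: gwalk.induct) (use adj_layer in fastforce)+

lemma walk_from_src:
  assumes "v \<in> verts G"
  shows "gwalk (adj G) (src G) v (layer G v)"
  using assms
proof (induction "layer G v" arbitrary: v)
  case 0
  then show ?case using layer_0 gwalk_nil by metis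
next
  case (Suc n)
  then obtain u where u: "adj G u v" "Suc (layer G u) = layer G v"
    using pred_ex[of v] by auto
  then have "gwalk (adj G) (src G) u (layer G u)"
    using Suc adj_verts by auto
  moreover have "gwalk (adj G) u v 1"
    using u gwalk.intros[of "adj G"] by fastforce
  ultimately show ?case
    using gwalk_append u(2) by fastforce
qed

text \<open>Any two nodes are joined by a walk through the source, so the \<open>LEAST\<close> in
  \<open>gdist\<close> is attained.\<close>

lemma gdist_walk:
  assumes "u \<in> verts G" "v \<in> verts G"
  shows "gwalk (adj G) u v (gdist G u v)"
proof -
  have "gwalk (adj G) u (src G) (layer G u)"
    using walk_from_src[OF assms(1)] gwalk_sym[of "adj G"] adj_sym by blast
  then have "\<exists>n. gwalk (adj G) u v n"
    using gwalk_append[OF _ walk_from_src[OF assms(2)]] by blast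
  then show ?thesis unfolding gdist_def by (rule LeastI_ex)
qed

lemma gdist_src: "v \<in> verts G \<Longrightarrow> gdist G (src G) v = layer G v"
  using gdist_le[OF walk_from_src] gdist_walk[OF src_verts] walk_layer layer_src
  by (metis add_0 antisym)

lemma gdist_adj:
  assumes "adj G u v"
  shows "gdist G u v = 1"
proof (rule antisym)
  show "gdist G u v \<le> 1"
    using assms gdist_le gwalk.intros[of "adj G"] by fastforce
  have "gdist G u v \<noteq> 0"
  proof
    assume "gdist G u v = 0"
    then have "gwalk (adj G) u v 0" using gdist_walk adj_verts assms by metis
    then have "u = v" by cases simp
    then show False using adj_layer assms by fastforce
  qed
  then show "1 \<le> gdist G u v" by simp
qed

end

section \<open>Schedules and outward-moving algorithms\<close>

abbreviation final_conf :: "'v lgraph \<Rightarrow> ('v \<Rightarrow> nat) \<Rightarrow> ('v \<times> 'v) list list \<Rightarrow> 'v \<Rightarrow> nat" where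
  "final_conf G \<equiv> foldl (apply_moves G)"

text \<open>\<open>sched_ok\<close> recurses from the first request, whereas online play grows at
  the end; this equivalence opens the way to reverse induction on the requests.\<close>

lemma sched_ok_snoc:
  "sched_ok G c (\<sigma> @ [r]) M \<longleftrightarrow>
     (\<exists>M' ms. M = M' @ [ms] \<and> sched_ok G c \<sigma> M' \<and> valid_moves G (final_conf G c M') ms \<and>
        occ G (apply_moves G (final_conf G c M') ms) r)"
proof (induction \<sigma> arbitrary: c M)
  case Nil
  show ?case
  proof (cases M)
    case M: (Cons ms mss)
    show ?thesis
    proof (cases mss)
      case Nil
      have "ms # [] = M' @ [ms'] \<longleftrightarrow> M' = [] \<and> ms' = ms" for M' ms'
        by (cases M') auto
      then show ?thesis using M Nil by auto
    next
      case (Cons ms' mss')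
      have "\<not> sched_ok G c [] M'" if "M = M' @ [x]" for M' x
        using that M Cons by (cases M') auto
      then show ?thesis using M Cons by auto
    qed
  qed simp
next
  case (Cons q \<sigma>)
  show ?case
  proof (cases M)
    case M: (Cons ms mss)
    show ?thesis (is "_ \<longleftrightarrow> ?R")
    proof
      assume "sched_ok G c ((q # \<sigma>) @ [r]) M"
      then obtain M' ms' where "mss = M' @ [ms']" "valid_moves G c ms"
        "occ G (apply_moves G c ms) q" "sched_ok G (apply_moves G c ms) \<sigma> M'"
        "valid_moves G (final_conf G (apply_moves G c ms) M') ms'"
        "occ G (apply_moves G (final_conf G (apply_moves G c ms) M') ms') r"
        using M Cons by auto
      then show ?R using M by (intro exI[of _ "ms # M'"]) auto
    next
      assume ?R
      then obtain M' ms' where R: "M = M' @ [ms']" "sched_ok G c (q # \<sigma>) M'"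
        "valid_moves G (final_conf G c M') ms'" "occ G (apply_moves G (final_conf G c M') ms') r"
        by blast
      then show "sched_ok G c ((q # \<sigma>) @ [r]) M"
        using Cons by (cases M') auto
    qed
  qed auto
qed

lemma alg_sched_snoc: "alg_sched A G (\<sigma> @ [r]) = alg_sched A G \<sigma> @ [A G (\<sigma> @ [r])]"
  unfolding alg_sched_def by (auto simp: nth_append)

lemma alg_conf_snoc:
  "alg_conf A G (\<sigma> @ [r]) = apply_moves G (alg_conf A G \<sigma>) (A G (\<sigma> @ [r]))"
  by (simp add: alg_conf_def alg_sched_snoc)

lemma sched_cost_snoc:
  "sched_cost G (M @ [ms]) = sched_cost G M + (\<Sum>m\<leftarrow>ms. gdist G (fst m) (snd m))"
  by (simp add: sched_cost_def)

lemma alg_cost_snoc: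
  "alg_cost A G (\<sigma> @ [r]) = alg_cost A G \<sigma> + (\<Sum>m\<leftarrow>A G (\<sigma> @ [r]). gdist G (fst m) (snd m))"
  by (simp add: alg_cost_def alg_sched_snoc sched_cost_snoc)

locale outward_alg = layered G D for G :: "'v lgraph" and D +
  fixes A :: "'v online_alg"
  assumes alg: "serves_all A G \<and> is_lazy A G \<and> is_local A G \<and> moves_outwards A G"
begin

abbreviation "conf \<equiv> alg_conf A G"
abbreviation "cost \<equiv> alg_cost A G"

lemma conf_Nil: "conf [] v = 0" "cost [] = 0"
  by (simp_all add: alg_conf_def alg_cost_def alg_sched_def init_conf_def sched_cost_def)

section \<open>Response of the algorithm to a single request\<close>

lemma serve_occupied:
  assumes "set (\<sigma> @ [r]) \<subseteq> verts G" "occ G (conf \<sigma>) r"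
  shows "A G (\<sigma> @ [r]) = []" "conf (\<sigma> @ [r]) = conf \<sigma>" "cost (\<sigma> @ [r]) = cost \<sigma>"
proof -
  have "is_lazy A G" using alg by simp
  then show 1: "A G (\<sigma> @ [r]) = []"
    using assms unfolding is_lazy_def by metis
  show "conf (\<sigma> @ [r]) = conf \<sigma>" "cost (\<sigma> @ [r]) = cost \<sigma>"
    by (simp_all add: alg_conf_snoc alg_cost_snoc apply_moves_def 1)
qed

lemma serve_unoccupied:
  assumes "set (\<sigma> @ [r]) \<subseteq> verts G" "\<not> occ G (conf \<sigma>) r"
  obtains a where "A G (\<sigma> @ [r]) = [(a, r)]" "a \<in> verts G" "occ G (conf \<sigma>) a" "a \<noteq> r"
    "outwalk G a r (gdist G a r)" "local_move G (conf \<sigma>) (a, r)"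
    "conf (\<sigma> @ [r]) = mv G (conf \<sigma>) (a, r)" "cost (\<sigma> @ [r]) = cost \<sigma> + gdist G a r"
proof -
  have "length (A G (\<sigma> @ [r])) = 1"
    using alg assms unfolding is_lazy_def by auto
  then obtain a b where ab: "A G (\<sigma> @ [r]) = [(a, b)]"
    by (metis One_nat_def Suc_length_conv length_0_conv surj_pair)
  have "sched_ok G init_conf (\<sigma> @ [r]) (alg_sched A G (\<sigma> @ [r]))"
    using alg assms(1) unfolding serves_all_def by blast
  then have ok: "valid_moves G (conf \<sigma>) [(a, b)]" "occ G (apply_moves G (conf \<sigma>) [(a, b)]) r"
    by (auto simp: sched_ok_snoc alg_sched_snoc ab alg_conf_def)
  \<comment> \<open>A single move makes no node other than its target newly occupied, and
    \<open>r\<close> was empty before it.\<close>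
  have "b = r"
    using ok(2) assms(2) by (auto simp: apply_moves_def mv_def occ_def Let_def split: if_splits)
  moreover have "\<forall>m\<in>set (A G (\<sigma> @ [r])). outwalk G (fst m) (snd m) (gdist G (fst m) (snd m))"
    using alg assms(1) unfolding moves_outwards_def by (metis snoc_eq_iff_butlast)
  moreover have "local_moves G (conf \<sigma>) (A G (\<sigma> @ [r]))"
    using alg assms(1) unfolding is_local_def by blast
  ultimately show thesis
    using ok assms(2) that[of a] ab
    by (auto simp: alg_conf_snoc alg_cost_snoc apply_moves_def)
qed

text \<open>Every move ends at the requested node and only when that node is empty, so servers never
  pile up and never stop at an unrequested node.\<close>

lemma conf_occupied_requested:
  assumes "set \<sigma> \<subseteq> verts G"
  shows "conf \<sigma> v \<le> 1" "0 < conf \<sigma> v \<Longrightarrow> v \<in> set \<sigma>"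
proof -
  have "conf \<sigma> v \<le> 1 \<and> (0 < conf \<sigma> v \<longrightarrow> v \<in> set \<sigma>)"
    using assms
  proof (induction \<sigma> rule: rev_induct)
    case (snoc r \<sigma>)
    show ?case
    proof (cases "occ G (conf \<sigma>) r")
      case True
      then show ?thesis using snoc serve_occupied(2) by auto
    next
      case False
      then obtain a where "conf (\<sigma> @ [r]) = mv G (conf \<sigma>) (a, r)"
        using serve_unoccupied snoc.prems by metis
      then show ?thesis
        using snoc False by (auto simp: mv_def occ_def Let_def split: if_splits)
    qed
  qed (simp add: conf_Nil)
  then show "conf \<sigma> v \<le> 1" "0 < conf \<sigma> v \<Longrightarrow> v \<in> set \<sigma>" by auto
qed

lemma opt_cost_le: "sched_ok G init_conf \<sigma> M \<Longrightarrow> opt_cost G \<sigma> \<le> sched_cost G M"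
  unfolding opt_cost_def by (rule Least_le) auto

text \<open>The algorithm's own schedule is feasible, so the minimum defining
  \<open>opt_cost\<close> is over a nonempty set and is attained.\<close>

lemma opt_sched_ex:
  assumes "set \<sigma> \<subseteq> verts G"
  obtains M where "sched_ok G init_conf \<sigma> M" "sched_cost G M = opt_cost G \<sigma>"
proof -
  have "\<exists>n M. sched_ok G init_conf \<sigma> M \<and> sched_cost G M = n"
    using alg assms unfolding serves_all_def by blast
  then have "\<exists>M. sched_ok G init_conf \<sigma> M \<and> sched_cost G M = opt_cost G \<sigma>"
    unfolding opt_cost_def by (rule LeastI_ex)
  then show thesis using that by blast
qed

end

section \<open>The upper bound\<close>

text \<open>The slope -1/2 is chosen to satisfy \<open>weight_edge\<close>. The value 0 at the
  source fits its unlimited supply: a departure from there changes no count.\<close>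

definition weight :: "nat \<Rightarrow> nat \<Rightarrow> real" where
  "weight D l = (if l = 0 then 0 else real D - 1 - real l / 2)"

text \<open>The second summand charges nodes, not servers: one online arrival at \<open>v\<close>
  releases it, however many offline servers stand there.\<close>

definition node_pot :: "'v lgraph \<Rightarrow> nat \<Rightarrow> ('v \<Rightarrow> nat) \<Rightarrow> ('v \<Rightarrow> nat) \<Rightarrow> 'v \<Rightarrow> real" where
  "node_pot G D s c v =
     real (c v) * weight D (layer G v) + (if 0 < c v \<and> s v = 0 then real (layer G v) else 0)"

text \<open>The finite set \<open>F\<close> stands for the nodes touched by either schedule.\<close>

definition pot :: "'v lgraph \<Rightarrow> nat \<Rightarrow> 'v set \<Rightarrow> ('v \<Rightarrow> nat) \<Rightarrow> ('v \<Rightarrow> nat) \<Rightarrow> real" where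
  "pot G D F s c = (\<Sum>v\<in>F - {src G}. node_pot G D s c v)"

text \<open>A move changes the potential only at its two end points; this isolates their
  contributions.\<close>

lemma sum_diff_two:
  fixes f g :: "'a \<Rightarrow> real"
  assumes "finite S" "a \<noteq> b" "\<And>v. v \<in> S \<Longrightarrow> v \<noteq> a \<Longrightarrow> v \<noteq> b \<Longrightarrow> f v = g v"
  shows "sum f S - sum g S =
    (if a \<in> S then f a - g a else 0) + (if b \<in> S then f b - g b else 0)"
proof -
  have "sum f S - sum g S = (\<Sum>v\<in>S. f v - g v)"
    by (simp add: sum_subtractf)
  also have "\<dots> = (\<Sum>v\<in>S. (if v = a then f a - g a else 0) + (if v = b then f b - g b else 0))"
    using assms by (intro sum.cong) auto
  also have "\<dots> = (if a \<in> S then f a - g a else 0) + (if b \<in> S then f b - g b else 0)"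
    using assms(1) by (simp add: sum.distrib sum.delta)
  finally show ?thesis .
qed

section \<open>Change of the potential under offline and online moves\<close>

context layered
begin

lemma weight_nonneg:
  assumes "D \<ge> 2" "v \<in> verts G"
  shows "0 \<le> weight D (layer G v)"
  using layer_le[OF assms(2)] assms(1) by (auto simp: weight_def)

text \<open>The left side is the most that an arrival at \<open>v\<close> can add, and
  \<open>weight\<close> at \<open>u\<close> is what the departure gives back. Equality holds from
  the source to layer 1 and, in both directions, between layers D - 1 and D.\<close>

lemma weight_edge:
  assumes "D \<ge> 2" "adj G u v"
  shows "weight D (layer G v) + real (layer G v) \<le> weight D (layer G u) + (real D - 1/2)"
proof -
  have "layer G u \<le> D" "layer G v \<le> D"
    using adj_verts assms layer_le by auto
  then show ?thesis
    using adj_layer[OF assms(2)] assms(1)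
    by (auto simp: weight_def field_simps)
qed

text \<open>Summing \<open>weight_edge\<close> along the walk keeps the layer term only at the final
  node; those of inner nodes are nonnegative and dropped. For \<open>u = v\<close> and
  \<open>n = 0\<close> the inequality fails off the source.\<close>

lemma weight_walk:
  assumes "D \<ge> 2"
  shows "gwalk (adj G) u v n \<Longrightarrow> u \<noteq> v \<Longrightarrow>
    weight D (layer G v) + real (layer G v) \<le> weight D (layer G u) + (real D - 1/2) * real n"
proof (induction rule: gwalk.induct)
  case (gwalk_step u w v n)
  have e: "weight D (layer G w) + real (layer G w) \<le> weight D (layer G u) + (real D - 1/2)"
    using weight_edge[OF assms gwalk_step.hyps(1)] .
  have Suc_n: "(real D - 1/2) * real (Suc n) = (real D - 1/2) + (real D - 1/2) * real n"
    by (simp add: algebra_simps)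
  show ?case
  proof (cases "w = v")
    case True
    have "0 \<le> (real D - 1/2) * real n" using assms by simp
    then show ?thesis using e Suc_n unfolding True by linarith
  next
    case False
    then have "weight D (layer G v) + real (layer G v)
        \<le> weight D (layer G w) + (real D - 1/2) * real n"
      by (rule gwalk_step.IH)
    then show ?thesis using e Suc_n by linarith
  qed
qed simp

lemma pot_nonneg: "D \<ge> 2 \<Longrightarrow> F \<subseteq> verts G \<Longrightarrow> 0 \<le> pot G D F s c"
  unfolding pot_def node_pot_def
  by (intro sum_nonneg add_nonneg_nonneg mult_nonneg_nonneg weight_nonneg) auto

lemma pot_mv_opt:
  assumes D: "D \<ge> 2" and F: "finite F" "a \<in> F" "b \<in> F" "F \<subseteq> verts G" and "occ G c a"
  shows "pot G D F s (mv G c (a, b)) \<le> pot G D F s c + (real D - 1/2) * real (gdist G a b)"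
proof (cases "a = b")
  case True
  \<comment> \<open>Away from the source, \<open>occ\<close> guarantees \<open>0 < c a\<close>, so
    truncated subtraction followed by \<open>Suc\<close> restores the count.\<close>
  then have "mv G c (a, b) = c"
    using assms by (auto simp: mv_def occ_def Let_def fun_eq_iff)
  then show ?thesis using D by simp
next
  case False
  let ?c = "mv G c (a, b)" and ?S = "F - {src G}"
  have "pot G D F s ?c - pot G D F s c =
    (if a \<in> ?S then node_pot G D s ?c a - node_pot G D s c a else 0) +
    (if b \<in> ?S then node_pot G D s ?c b - node_pot G D s c b else 0)"
    unfolding pot_def using F False
    by (intro sum_diff_two) (auto simp: node_pot_def mv_def Let_def)
  \<comment> \<open>Only an inequality: if the last offline server leaves \<open>a\<close>, its
    layer charge may disappear as well.\<close>
  moreover have "(if a \<in> ?S then node_pot G D s ?c a - node_pot G D s c a else 0)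
      \<le> - weight D (layer G a)"
  proof (cases "a = src G")
    case True
    then show ?thesis by (simp add: weight_def layer_src)
  next
    case a: False
    then obtain k where "c a = Suc k"
      using assms(6) by (auto simp: occ_def gr0_conv_Suc)
    then show ?thesis
      using False a F by (auto simp: node_pot_def mv_def Let_def algebra_simps)
  qed
  moreover have "(if b \<in> ?S then node_pot G D s ?c b - node_pot G D s c b else 0)
      \<le> weight D (layer G b) + real (layer G b)"
    using False F
    by (auto simp: node_pot_def mv_def Let_def weight_def layer_src algebra_simps)
  moreover have "weight D (layer G b) + real (layer G b)
      \<le> weight D (layer G a) + (real D - 1/2) * real (gdist G a b)"
    using weight_walk[OF D gdist_walk] F False by blast
  ultimately show ?thesis by linarith
qed

lemma pot_apply_moves_opt:
  assumes D: "D \<ge> 2" and F: "finite F" "F \<subseteq> verts G"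
  shows "valid_moves G c ms \<Longrightarrow> fst ` set ms \<union> snd ` set ms \<subseteq> F \<Longrightarrow>
    pot G D F s (apply_moves G c ms)
      \<le> pot G D F s c + (real D - 1/2) * real (\<Sum>m\<leftarrow>ms. gdist G (fst m) (snd m))"
proof (induction ms arbitrary: c)
  case (Cons m ms)
  obtain a b where m: "m = (a, b)" by fastforce
  have "pot G D F s (mv G c m) \<le> pot G D F s c + (real D - 1/2) * real (gdist G a b)"
    unfolding m using Cons.prems D F m by (intro pot_mv_opt) auto
  moreover have "pot G D F s (apply_moves G (mv G c m) ms)
    \<le> pot G D F s (mv G c m) + (real D - 1/2) * real (\<Sum>m\<leftarrow>ms. gdist G (fst m) (snd m))"
    using Cons by auto
  ultimately show ?case
    by (simp add: apply_moves_def m algebra_simps)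
qed (simp add: apply_moves_def)

text \<open>Arrival at \<open>r\<close>, occupied offline but not online, releases
  \<open>layer G r\<close>; departure from \<open>a\<close> creates a charge of at most
  \<open>layer G a\<close>. The difference \<open>n\<close> pays for the outward move.\<close>

lemma pot_mv_alg:
  assumes F: "finite F" "a \<in> F" "r \<in> F"
    and "a \<noteq> r" "occ G s a" "\<not> occ G s r" "occ G c r" "layer G r = layer G a + n"
  shows "pot G D F (mv G s (a, r)) c + real n \<le> pot G D F s c"
proof -
  let ?s = "mv G s (a, r)" and ?S = "F - {src G}"
  have "pot G D F ?s c - pot G D F s c =
    (if a \<in> ?S then node_pot G D ?s c a - node_pot G D s c a else 0) +
    (if r \<in> ?S then node_pot G D ?s c r - node_pot G D s c r else 0)"
    unfolding pot_def using assms
    by (intro sum_diff_two) (auto simp: node_pot_def mv_def Let_def)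
  moreover have "(if a \<in> ?S then node_pot G D ?s c a - node_pot G D s c a else 0)
      \<le> real (layer G a)"
    using assms by (auto simp: node_pot_def mv_def Let_def)
  moreover have "(if r \<in> ?S then node_pot G D ?s c r - node_pot G D s c r else 0)
      = - real (layer G r)"
    using assms by (auto simp: node_pot_def mv_def Let_def occ_def)
  ultimately show ?thesis using assms(8) by linarith
qed

end

text \<open>In each round the offline moves are accounted for first, since \<open>pot_mv_alg\<close>
  needs the request to be covered offline already. The set \<open>F\<close> is fixed for all rounds,
  so potentials at different times are comparable finite sums even on infinite graphs.\<close>

lemma (in outward_alg) alg_cost_potential:
  assumes D: "D \<ge> 2" and F: "finite F" "F \<subseteq> verts G"
  shows "set \<sigma> \<subseteq> verts G \<Longrightarrow> sched_ok G init_conf \<sigma> M \<Longrightarrow>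
    (\<Union>m\<in>set (concat M) \<union> set (concat (alg_sched A G \<sigma>)). {fst m, snd m}) \<subseteq> F \<Longrightarrow>
    real (cost \<sigma>) + pot G D F (conf \<sigma>) (final_conf G init_conf M)
      \<le> (real D - 1/2) * real (sched_cost G M)"
proof (induction \<sigma> arbitrary: M rule: rev_induct)
  case Nil
  then have "M = []" by (cases M) auto
  then show ?case
    by (simp add: conf_Nil sched_cost_def pot_def node_pot_def init_conf_def)
next
  case (snoc r \<sigma>)
  obtain M' ms where M: "M = M' @ [ms]" "sched_ok G init_conf \<sigma> M'"
    "valid_moves G (final_conf G init_conf M') ms"
    "occ G (apply_moves G (final_conf G init_conf M') ms) r"
    using snoc.prems(2) unfolding sched_ok_snoc by blast
  let ?c = "final_conf G init_conf M'" and ?c' = "final_conf G init_conf M"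
  have "real (cost \<sigma>) + pot G D F (conf \<sigma>) ?c \<le> (real D - 1/2) * real (sched_cost G M')"
    using snoc.prems M by (intro snoc.IH) (auto simp: alg_sched_snoc)
  moreover have "fst ` set ms \<union> snd ` set ms \<subseteq> F"
    using snoc.prems(3) M(1) by auto
  then have "pot G D F (conf \<sigma>) ?c'
      \<le> pot G D F (conf \<sigma>) ?c + (real D - 1/2) * real (\<Sum>m\<leftarrow>ms. gdist G (fst m) (snd m))"
    using pot_apply_moves_opt[OF D F M(3)] M(1) by simp
  moreover have "real (cost (\<sigma> @ [r])) + pot G D F (conf (\<sigma> @ [r])) ?c'
      \<le> real (cost \<sigma>) + pot G D F (conf \<sigma>) ?c'"
  proof (cases "occ G (conf \<sigma>) r")
    case True
    then show ?thesis using serve_occupied snoc.prems(1) by simp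
  next
    case False
    then obtain a where a: "A G (\<sigma> @ [r]) = [(a, r)]" "occ G (conf \<sigma>) a" "a \<noteq> r"
      "outwalk G a r (gdist G a r)" "conf (\<sigma> @ [r]) = mv G (conf \<sigma>) (a, r)"
      "cost (\<sigma> @ [r]) = cost \<sigma> + gdist G a r"
      using serve_unoccupied snoc.prems(1) by metis
    have "a \<in> F" "r \<in> F"
      using snoc.prems(3) a(1) by (auto simp: alg_sched_snoc)
    then have "pot G D F (mv G (conf \<sigma>) (a, r)) ?c' + real (gdist G a r) \<le> pot G D F (conf \<sigma>) ?c'"
      using a False M outwalk_layer[OF a(4)] by (intro pot_mv_alg[OF F(1)]) auto
    then show ?thesis using a by simp
  qed
  ultimately show ?case
    by (simp add: M(1) sched_cost_snoc algebra_simps)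
qed

lemma valid_moves_verts: "valid_moves G c ms \<Longrightarrow> m \<in> set ms \<Longrightarrow> fst m \<in> verts G \<and> snd m \<in> verts G"
  by (induction ms arbitrary: c) auto

lemma sched_ok_verts:
  "sched_ok G c \<sigma> M \<Longrightarrow> m \<in> set (concat M) \<Longrightarrow> fst m \<in> verts G \<and> snd m \<in> verts G"
proof (induction G c \<sigma> M rule: sched_ok.induct)
  case (2 G c r rs ms mss)
  then show ?case using valid_moves_verts[of G c ms m] by auto
qed auto

lemma (in outward_alg) competitive_upper:
  assumes D: "D \<ge> 2"
  shows "competitive A G (real D - 1/2)"
  unfolding competitive_def
\<comment> \<open>The additive constant is 0: the potential starts at 0 and is never
  negative.\<close>
proof (intro exI[of _ 0] allI impI)
  fix \<sigma> assume \<sigma>: "set \<sigma> \<subseteq> verts G"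
  obtain M where M: "sched_ok G init_conf \<sigma> M" "sched_cost G M = opt_cost G \<sigma>"
    using opt_sched_ex[OF \<sigma>] .
  define F where "F = (\<Union>m\<in>set (concat M) \<union> set (concat (alg_sched A G \<sigma>)). {fst m, snd m})"
  have "sched_ok G init_conf \<sigma> (alg_sched A G \<sigma>)"
    using alg \<sigma> unfolding serves_all_def by blast
  then have "F \<subseteq> verts G"
    using sched_ok_verts M(1) unfolding F_def by fast
  moreover have "finite F" unfolding F_def by auto
  ultimately have "real (cost \<sigma>) + pot G D F (conf \<sigma>) (final_conf G init_conf M)
      \<le> (real D - 1/2) * real (sched_cost G M)"
    using alg_cost_potential[OF D _ _ \<sigma> M(1)] unfolding F_def by blast
  then show "real (cost \<sigma>) \<le> (real D - 1/2) * real (opt_cost G \<sigma>) + 0"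
    using pot_nonneg[OF D \<open>F \<subseteq> verts G\<close>] M(2) by (smt (verit))
qed

section \<open>The lower bound\<close>

datatype node = P nat | B nat | R nat nat

text \<open>Countability allows the nodes to be embedded in any infinite type.\<close>

instance node :: countable
  by countable_datatype

fun node_layer :: "nat \<Rightarrow> node \<Rightarrow> nat" where
  "node_layer D (P i) = i"
| "node_layer D (B j) = D - 1"
| "node_layer D (R x t) = D"

text \<open>Edges are listed in the outward direction only; \<open>hard_graph\<close> symmetrises
  them.\<close>

fun node_edge :: "nat \<Rightarrow> node \<Rightarrow> node \<Rightarrow> bool" where
  "node_edge D (P i) (P j) = (j = Suc i \<and> j \<le> D - 2)"
| "node_edge D (P i) (B j) = (i = D - 2)"
| "node_edge D (B j) (R x t) = (j = x \<or> j = t \<or> j = Suc t)"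
| "node_edge D _ _ = False"

text \<open>For D = 2 the path shrinks to the source \<open>P 0\<close>.\<close>

definition nodes :: "nat \<Rightarrow> node set" where
  "nodes D = {p. \<forall>i. p = P i \<longrightarrow> i \<le> D - 2}"

text \<open>The algorithm acts on graphs over the fixed type \<open>'v\<close>, so the construction
  is transported along \<open>f\<close>; for injective \<open>f\<close>, \<open>inv f\<close>
  recovers the original node.\<close>

definition hard_graph :: "nat \<Rightarrow> (node \<Rightarrow> 'v) \<Rightarrow> 'v lgraph" where
  "hard_graph D f = \<lparr> verts = f ` nodes D,
     adj = (\<lambda>u v. \<exists>p\<in>nodes D. \<exists>q\<in>nodes D.
              u = f p \<and> v = f q \<and> (node_edge D p q \<or> node_edge D q p)),
     layer = (\<lambda>v. node_layer D (inv f v)), src = f (P 0) \<rparr>"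

lemma
  assumes inj: "inj f"
  shows hard_graph_verts: "verts (hard_graph D f) = f ` nodes D"
    and hard_graph_src: "src (hard_graph D f) = f (P 0)"
    and hard_graph_layer: "layer (hard_graph D f) (f p) = node_layer D p"
    and hard_graph_adj: "adj (hard_graph D f) (f p) (f q) \<longleftrightarrow>
      p \<in> nodes D \<and> q \<in> nodes D \<and> (node_edge D p q \<or> node_edge D q p)"
  using inj by (auto simp: hard_graph_def inj_eq)

lemma layered_hard_graph:
  assumes D: "D \<ge> 2" and f: "inj f"
  shows "layered_graph (hard_graph D f) D"
proof -
  have edge: "node_layer D q = Suc (node_layer D p)" if "node_edge D p q" for p q
    using that D by (induction D p q rule: node_edge.induct) auto
  have le: "node_layer D p \<le> D" if "p \<in> nodes D" for p
    using that by (cases p) (auto simp: nodes_def)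
  have zero: "p = P 0" if "node_layer D p = 0" for p
    using that D by (cases p) auto
  have pred: "\<exists>q\<in>nodes D. node_edge D q p \<and> Suc (node_layer D q) = node_layer D p"
    if "p \<in> nodes D" "0 < node_layer D p" for p
  proof (cases p)
    case (P i)
    then show ?thesis using that by (intro bexI[of _ "P (i - 1)"]) (auto simp: nodes_def)
  next
    case (B j)
    then show ?thesis using D by (intro bexI[of _ "P (D - 2)"]) (auto simp: nodes_def)
  next
    case (R x t)
    then show ?thesis using D by (intro bexI[of _ "B x"]) (auto simp: nodes_def)
  qed
  have top: "R 0 0 \<in> nodes D" "P 0 \<in> nodes D"
    by (auto simp: nodes_def)
  let ?G = "hard_graph D f"
  note [simp] = hard_graph_verts[OF f] hard_graph_src[OF f] hard_graph_layer[OF f] hard_graph_adj[OF f]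
  have nodes: "\<exists>p\<in>nodes D. \<exists>q\<in>nodes D. u = f p \<and> v = f q \<and> (node_edge D p q \<or> node_edge D q p)"
    if "adj ?G u v" for u v
    using that by (simp add: hard_graph_def)
  show ?thesis
    unfolding layered_graph_def
  proof (intro conjI allI ballI impI)
    fix u v assume "adj ?G u v"
    then obtain p q where pq: "p \<in> nodes D" "q \<in> nodes D" "u = f p" "v = f q"
      "node_edge D p q \<or> node_edge D q p"
      using nodes by blast
    show "u \<in> verts ?G" "v \<in> verts ?G" "adj ?G v u"
      using pq by auto
    show "layer ?G v = Suc (layer ?G u) \<or> layer ?G u = Suc (layer ?G v)"
      using pq edge by auto
  next
    fix v assume "v \<in> verts ?G"
    then obtain p where p: "p \<in> nodes D" "v = f p" by auto
    then show "layer ?G v \<le> D" using le by simp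
    show "v = src ?G" if "layer ?G v = 0"
      using that p zero by simp
    show "\<exists>u. adj ?G u v \<and> Suc (layer ?G u) = layer ?G v" if layer: "0 < layer ?G v"
    proof -
      obtain q where "q \<in> nodes D" "node_edge D q p" "Suc (node_layer D q) = node_layer D p"
        using pred[OF p(1)] layer p(2) by auto
      then show ?thesis using p by (intro exI[of _ "f q"]) simp
    qed
  next
    show "\<exists>v\<in>verts ?G. layer ?G v = D"
      using top by (intro bexI[of _ "f (R 0 0)"]) auto
    show "src ?G \<in> verts ?G" "layer ?G (src ?G) = 0"
      using top by auto
  qed
qed

section \<open>Forced answers of the algorithm on the hard graph\<close>

locale hard_instance = outward_alg "hard_graph D f" D A
  for D and f :: "node \<Rightarrow> 'v" and A +
  assumes D2: "D \<ge> 2" and inj_f: "inj f"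
begin

abbreviation "G \<equiv> hard_graph D f"

lemmas verts_G = hard_graph_verts[OF inj_f, of D]
  and src_G = hard_graph_src[OF inj_f, of D]
  and layer_G = hard_graph_layer[OF inj_f, of D]
  and adj_G = hard_graph_adj[OF inj_f, of D]

lemma B_verts [simp]: "f (B j) \<in> verts G" and R_verts [simp]: "f (R x t) \<in> verts G"
  by (auto simp: verts_G nodes_def)

lemma f_eq [simp]: "f p = f q \<longleftrightarrow> p = q"
  using inj_f by (rule inj_eq)

lemma requests_verts: "S \<subseteq> f ` (- range P) \<Longrightarrow> S \<subseteq> verts G"
  unfolding verts_G nodes_def by blast

lemma requests_no_P: "S \<subseteq> f ` (- range P) \<Longrightarrow> f (P i) \<notin> S"
proof
  assume "S \<subseteq> f ` (- range P)" "f (P i) \<in> S"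
  then obtain p where "p \<notin> range P" "f (P i) = f p" by blast
  then show False by auto
qed

text \<open>An outward move to layer D - 1 starts at a path node. The path is never requested, so
  among its nodes only the source is occupied, and the full D - 1 is paid.\<close>

lemma request_B:
  assumes "set \<sigma> \<subseteq> f ` (- range P)" "conf \<sigma> (f (B j)) = 0"
  shows "conf (\<sigma> @ [f (B j)]) = (conf \<sigma>)(f (B j) := 1)"
    and "cost (\<sigma> @ [f (B j)]) = cost \<sigma> + (D - 1)"
proof -
  have s: "set \<sigma> \<subseteq> verts G" using assms(1) by (rule requests_verts)
  have no: "\<not> occ G (conf \<sigma>) (f (B j))"
    using assms(2) by (auto simp: occ_def src_G)
  obtain a where a: "a \<in> verts G" "occ G (conf \<sigma>) a" "a \<noteq> f (B j)"
    "outwalk G a (f (B j)) (gdist G a (f (B j)))"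
    "conf (\<sigma> @ [f (B j)]) = mv G (conf \<sigma>) (a, f (B j))"
    "cost (\<sigma> @ [f (B j)]) = cost \<sigma> + gdist G a (f (B j))"
    using serve_unoccupied[OF _ no] s by auto
  obtain p where p: "a = f p" "p \<in> nodes D" using a(1) verts_G by auto
  have lay: "D - 1 = node_layer D p + gdist G a (f (B j))"
    using outwalk_layer[OF a(4)] by (simp add: layer_G p)
  have "p = P 0"
  proof (cases p)
    case (P i)
    then have "f (P i) \<notin> set \<sigma>" using requests_no_P[OF assms(1)] by blast
    then show ?thesis
      using a(2) conf_occupied_requested(2)[OF s] by (auto simp: occ_def src_G p P)
  next
    case (B k)
    then have "outwalk G a (f (p)) 0 \<and> gdist G a (f (B j)) = 0" using lay p by (auto intro: outwalk_nil)
    then have "outwalk G a (f (B j)) 0" using a(4) by simp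
    then have "a = f (B j)" by cases simp
    then show ?thesis using a(3) by simp
  next
    case (R x t)
    then show ?thesis using lay D2 by simp
  qed
  then show "conf (\<sigma> @ [f (B j)]) = (conf \<sigma>)(f (B j) := 1)"
    "cost (\<sigma> @ [f (B j)]) = cost \<sigma> + (D - 1)"
    using a lay assms(2) by (auto simp: p mv_def src_G Let_def fun_eq_iff)
qed

text \<open>Locality excludes the source, because the occupied \<open>B x\<close> lies on a shortest
  path from it to \<open>R x t\<close>. What remains is a neighbour in layer D - 1, and
  \<open>B (Suc t)\<close> is empty.\<close>

lemma request_R:
  assumes "set \<sigma> \<subseteq> f ` (- range P)" "conf \<sigma> (f (R x t)) = 0"
    and "0 < conf \<sigma> (f (B x))" "conf \<sigma> (f (B (Suc t))) = 0"
  obtains y where "y \<in> {x, t}"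
    "conf (\<sigma> @ [f (R x t)]) = (conf \<sigma>)(f (B y) := 0, f (R x t) := 1)"
    "cost (\<sigma> @ [f (R x t)]) = cost \<sigma> + 1"
proof -
  have s: "set \<sigma> \<subseteq> verts G" using assms(1) by (rule requests_verts)
  have no: "\<not> occ G (conf \<sigma>) (f (R x t))"
    using assms(2) by (auto simp: occ_def src_G)
  obtain a where a: "a \<in> verts G" "occ G (conf \<sigma>) a" "a \<noteq> f (R x t)"
    "outwalk G a (f (R x t)) (gdist G a (f (R x t)))" "local_move G (conf \<sigma>) (a, f (R x t))"
    "conf (\<sigma> @ [f (R x t)]) = mv G (conf \<sigma>) (a, f (R x t))"
    "cost (\<sigma> @ [f (R x t)]) = cost \<sigma> + gdist G a (f (R x t))"
    using serve_unoccupied[OF _ no] s by auto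
  obtain p where p: "a = f p" "p \<in> nodes D" using a(1) verts_G by auto
  have lay: "D = node_layer D p + gdist G a (f (R x t))"
    using outwalk_layer[OF a(4)] by (simp add: layer_G p)
  have "\<exists>y\<in>{x, t}. p = B y"
  proof (cases p)
    case (P i)
    then have "f (P i) \<notin> set \<sigma>" using requests_no_P[OF assms(1)] by blast
    then have src: "a = src G"
      using a(2) conf_occupied_requested(2)[OF s] by (auto simp: occ_def p P)
    have "gdist G (f (B x)) (f (R x t)) = 1"
      by (rule gdist_adj) (auto simp: adj_G nodes_def)
    then have "gdist G a (f (R x t)) = gdist G a (f (B x)) + gdist G (f (B x)) (f (R x t))"
      using D2 by (simp add: src gdist_src layer_G)
    moreover have "f (B x) \<noteq> a" by (simp add: src src_G)
    ultimately show ?thesis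
      using a(5) assms(3) B_verts[of x] unfolding local_move_def by (auto simp: occ_def)
  next
    case (B k)
    then have "gdist G a (f (R x t)) = 1" using lay D2 by simp
    then have "outwalk G a (f (R x t)) (Suc 0)" using a(4) by simp
    then obtain w where "adj G a w" "outwalk G w (f (R x t)) 0"
      by cases auto
    moreover from this(2) have "w = f (R x t)" by cases simp
    ultimately have "node_edge D (B k) (R x t)"
      by (auto simp: adj_G p B)
    moreover have "k \<noteq> Suc t"
      using a(2) assms(4) by (auto simp: occ_def src_G p B)
    ultimately show ?thesis using B by auto
  next
    case (R x' t')
    then have "outwalk G a (f (R x t)) 0" using a(4) lay by simp
    then have "a = f (R x t)" by cases simp
    then show ?thesis using a(3) by simp
  qed
  then obtain y where y: "y \<in> {x, t}" "p = B y" by blast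
  \<comment> \<open>A node holds at most one online server, so the departure empties
    \<open>B y\<close>.\<close>
  have "conf \<sigma> (f (B y)) - 1 = 0"
    using conf_occupied_requested(1)[OF s, of "f (B y)"] by simp
  then have "conf (\<sigma> @ [f (R x t)]) = (conf \<sigma>)(f (B y) := 0, f (R x t) := 1)"
    using a(6) assms(2) by (auto simp: p y mv_def src_G Let_def fun_eq_iff)
  moreover have "gdist G a (f (R x t)) = 1" using lay D2 y(2) by simp
  ultimately show thesis using that y a(7) by simp
qed

text \<open>Beyond the costs, the induction carries that both players hold \<open>B x\<close> and
  \<open>B (Suc n)\<close>, that these differ (\<open>x \<le> n\<close>), and that all requested
  indices are bounded, so the next round finds fresh nodes \<open>R x (Suc n)\<close> and
  \<open>B (Suc (Suc n))\<close>.\<close>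

lemma adversary:
  "\<exists>\<sigma> M x. x \<le> n \<and> set \<sigma> \<subseteq> f ` (B ` {..Suc n} \<union> {R y j |y j. j \<le> n}) \<and>
     sched_ok G init_conf \<sigma> M \<and> sched_cost G M \<le> 2 * (D - 1) + 2 * n \<and>
     0 < final_conf G init_conf M (f (B x)) \<and> 0 < final_conf G init_conf M (f (B (Suc n))) \<and>
     0 < conf \<sigma> (f (B x)) \<and> 0 < conf \<sigma> (f (B (Suc n))) \<and>
     cost \<sigma> = 2 * (D - 1) + n * (2 * D - 1)"
proof (induction n)
  case 0
  \<comment> \<open>Requesting \<open>B 0\<close> and \<open>B 1\<close> sets up the two servers;
    the offline player copies the online schedule.\<close>
  let ?\<sigma> = "([] @ [f (B 0)]) @ [f (B 1)]"
  note b0 = request_B[of "[]" 0, simplified conf_Nil, simplified]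
  have c1: "conf ?\<sigma> = (conf [f (B 0)])(f (B 1) := 1)" "cost ?\<sigma> = cost [f (B 0)] + (D - 1)"
    using request_B[of "[f (B 0)]" 1] b0 by (auto simp: conf_Nil)
  have "set ?\<sigma> \<subseteq> verts G" by auto
  then have "sched_ok G init_conf ?\<sigma> (alg_sched A G ?\<sigma>)"
    using alg unfolding serves_all_def by blast
  moreover have "final_conf G init_conf (alg_sched A G ?\<sigma>) = conf ?\<sigma>"
    by (simp add: alg_conf_def)
  moreover have "sched_cost G (alg_sched A G ?\<sigma>) = cost ?\<sigma>"
    by (simp add: alg_cost_def)
  ultimately show ?case
    using c1 b0
    by (intro exI[of _ ?\<sigma>] exI[of _ "alg_sched A G ?\<sigma>"] exI[of _ 0]) auto
next
  case (Suc n)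
  then obtain \<sigma> M x where IH: "x \<le> n"
    "set \<sigma> \<subseteq> f ` (B ` {..Suc n} \<union> {R y j |y j. j \<le> n})"
    "sched_ok G init_conf \<sigma> M" "sched_cost G M \<le> 2 * (D - 1) + 2 * n"
    "0 < final_conf G init_conf M (f (B x))" "0 < final_conf G init_conf M (f (B (Suc n)))"
    "0 < conf \<sigma> (f (B x))" "0 < conf \<sigma> (f (B (Suc n)))"
    "cost \<sigma> = 2 * (D - 1) + n * (2 * D - 1)"
    by blast
  define t where "t = Suc n"
  let ?r = "f (R x t)" and ?b = "f (B (Suc t))"
  have \<sigma>: "set \<sigma> \<subseteq> f ` (- range P)" using IH(2) by auto
  then have s: "set \<sigma> \<subseteq> verts G" by (rule requests_verts)
  have "?r \<notin> set \<sigma>" "?b \<notin> set \<sigma>" using IH(2) by (auto simp: t_def)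
  then have new: "conf \<sigma> ?r = 0" "conf \<sigma> ?b = 0"
    using conf_occupied_requested(2)[OF s] by auto
  obtain y where y: "y \<in> {x, t}"
    "conf (\<sigma> @ [?r]) = (conf \<sigma>)(f (B y) := 0, ?r := 1)" "cost (\<sigma> @ [?r]) = cost \<sigma> + 1"
    using request_R[OF \<sigma> new(1) IH(7) new(2)] .
  \<comment> \<open>The online player vacates \<open>B y\<close>; \<open>z\<close> indexes the other
    node of the pair, whose server the offline player uses.\<close>
  define z where "z = (if y = x then t else x)"
  have zt: "z \<in> {x, t}" "z \<noteq> y" "y \<le> t" "z \<le> t" using y(1) IH(1) by (auto simp: z_def t_def)
  let ?\<sigma>2 = "(\<sigma> @ [?r]) @ [f (B y)]" and ?\<sigma>3 = "((\<sigma> @ [?r]) @ [f (B y)]) @ [?b]"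
  have c2: "conf ?\<sigma>2 = (conf (\<sigma> @ [?r]))(f (B y) := 1)" "cost ?\<sigma>2 = cost (\<sigma> @ [?r]) + (D - 1)"
    using \<sigma> y(2) by (intro request_B; auto)+
  have c3: "conf ?\<sigma>3 = (conf ?\<sigma>2)(?b := 1)" "cost ?\<sigma>3 = cost ?\<sigma>2 + (D - 1)"
    using \<sigma> y(2) c2(1) new zt by (intro request_B; auto)+
  \<comment> \<open>Offline, \<open>B z\<close> serves \<open>R x t\<close>, the untouched server at
    \<open>B y\<close> serves the second request for free, and the server at \<open>R x t\<close>
    steps on to \<open>B (Suc t)\<close>. The next pair is \<open>B y\<close> and
    \<open>B (Suc t)\<close>.\<close>
  let ?M = "((M @ [[(f (B z), ?r)]]) @ [[]]) @ [[(?r, ?b)]]"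
  let ?c = "final_conf G init_conf M"
  have cM: "0 < ?c (f (B y))" "0 < ?c (f (B z))"
    using IH(5,6) y(1) zt(1) by (auto simp: t_def)
  have c': "mv G ?c (f (B z), ?r) = ?c(f (B z) := ?c (f (B z)) - 1, ?r := Suc (?c ?r))"
    by (auto simp: mv_def src_G Let_def fun_eq_iff)
  have c'': "mv G (mv G ?c (f (B z), ?r)) (?r, ?b) =
      ?c(f (B z) := ?c (f (B z)) - 1, ?b := Suc (?c ?b))"
    using zt by (auto simp: c' mv_def src_G Let_def fun_eq_iff t_def)
  have fin: "final_conf G init_conf ?M = mv G (mv G ?c (f (B z), ?r)) (?r, ?b)"
    by (simp add: apply_moves_def)
  have "sched_ok G init_conf ?\<sigma>3 ?M"
    unfolding sched_ok_snoc using IH(3) cM zt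
    by (auto simp: apply_moves_def c' occ_def src_G mv_def Let_def)
  moreover have "gdist G (f (B z)) ?r = 1"
    using zt by (intro gdist_adj) (auto simp: adj_G nodes_def)
  moreover have "gdist G ?r ?b = 1"
    by (intro gdist_adj) (auto simp: adj_G nodes_def)
  ultimately have M: "sched_ok G init_conf ?\<sigma>3 ?M" "sched_cost G ?M \<le> 2 * (D - 1) + 2 * Suc n"
    using IH(4) by (auto simp: sched_cost_def)
  have pos: "0 < final_conf G init_conf ?M (f (B y))" "0 < final_conf G init_conf ?M ?b"
    unfolding fin c'' using cM zt by auto
  have "set ?\<sigma>3 \<subseteq> f ` (B ` {..Suc (Suc n)} \<union> {R y j |y j. j \<le> Suc n})"
    using IH(2) zt by (force simp: t_def)
  moreover have "0 < conf ?\<sigma>3 (f (B y))" "0 < conf ?\<sigma>3 ?b"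
    using c3(1) c2(1) by auto
  moreover have "cost ?\<sigma>3 = 2 * (D - 1) + Suc n * (2 * D - 1)"
  proof -
    have "1 + (D - 1) + (D - 1) = 2 * D - 1" using D2 by simp
    then show ?thesis
      unfolding c3(2) c2(2) y(3) IH(9) mult_Suc by linarith
  qed
  ultimately show ?case
    using M pos zt(3) unfolding t_def by blast
qed

lemma not_competitive:
  assumes \<rho>: "\<rho> < real D - 1/2"
  shows "\<not> competitive A G \<rho>"
proof
  assume "competitive A G \<rho>"
  then obtain c where c: "\<And>\<sigma>. set \<sigma> \<subseteq> verts G \<Longrightarrow> real (cost \<sigma>) \<le> \<rho> * real (opt_cost G \<sigma>) + c"
    unfolding competitive_def by blast
  \<comment> \<open>Only an upper bound on \<open>opt_cost\<close> is known, so the factor in front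
    of it must be nonnegative.\<close>
  define q where "q = max \<rho> 0"
  have q: "0 \<le> q" "\<rho> \<le> q" "q < real D - 1/2" using \<rho> D2 by (auto simp: q_def)
  \<comment> \<open>The left side grows in \<open>n\<close> with positive slope while the right side
    is constant, which is absurd for large \<open>n\<close>.\<close>
  have bound: "real n * (2 * real D - 1 - 2 * q) \<le> q * (2 * (real D - 1)) + c" for n
  proof -
    obtain \<sigma> M where \<sigma>: "set \<sigma> \<subseteq> f ` (B ` {..Suc n} \<union> {R y j |y j. j \<le> n})"
      "sched_ok G init_conf \<sigma> M" "sched_cost G M \<le> 2 * (D - 1) + 2 * n"
      "cost \<sigma> = 2 * (D - 1) + n * (2 * D - 1)"
      using adversary[of n] by blast
    have "set \<sigma> \<subseteq> verts G" using \<sigma>(1) by auto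
    then have "real (cost \<sigma>) \<le> \<rho> * real (opt_cost G \<sigma>) + c" by (rule c)
    also have "\<dots> \<le> q * real (opt_cost G \<sigma>) + c"
      using q by (simp add: mult_right_mono)
    also have "\<dots> \<le> q * real (2 * (D - 1) + 2 * n) + c"
      using opt_cost_le[OF \<sigma>(2)] \<sigma>(3) q(1) by (intro add_right_mono mult_left_mono of_nat_mono) auto
    finally have "real (2 * (D - 1) + n * (2 * D - 1)) \<le> q * real (2 * (D - 1) + 2 * n) + c"
      using \<sigma>(4) by simp
    moreover have "real (2 * (D - 1) + n * (2 * D - 1)) = 2 * (real D - 1) + real n * (2 * real D - 1)"
      "real (2 * (D - 1) + 2 * n) = 2 * (real D - 1) + 2 * real n"
      using D2 by (auto simp: of_nat_diff)
    ultimately have "2 * (real D - 1) + real n * (2 * real D - 1)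
        \<le> q * (2 * (real D - 1) + 2 * real n) + c"
      by simp
    then show ?thesis using D2 by (simp add: algebra_simps)
  qed
  obtain n where "q * (2 * (real D - 1)) + c < real n * (2 * real D - 1 - 2 * q)"
    using reals_Archimedean3[of "2 * real D - 1 - 2 * q"] q(3) by auto
  then show False using bound[of n] by simp
qed

end

theorem theorem7:
  fixes D :: nat and MOO :: "'v online_alg"
  assumes "D \<ge> 2"
    and "infinite (UNIV :: 'v set)"
    and "\<And>G :: 'v lgraph. layered_graph G D \<Longrightarrow>
           serves_all MOO G \<and> is_lazy MOO G \<and> is_local MOO G \<and> moves_outwards MOO G"
  shows "(\<forall>G :: 'v lgraph. layered_graph G D \<longrightarrow> competitive MOO G (real D - 1/2)) \<and>
         (\<forall>\<rho>::real. \<rho> < real D - 1/2 \<longrightarrow>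
            (\<exists>G :: 'v lgraph. layered_graph G D \<and> \<not> competitive MOO G \<rho>))"
proof (intro conjI allI impI)
  fix G :: "'v lgraph" assume "layered_graph G D"
  then interpret outward_alg G D MOO
    using assms(3) by unfold_locales
  show "competitive MOO G (real D - 1/2)"
    using assms(1) by (rule competitive_upper)
next
  fix \<rho> :: real assume \<rho>: "\<rho> < real D - 1/2"
  \<comment> \<open>An infinite type contains a copy of the naturals, hence of the countable type
    \<open>node\<close>.\<close>
  obtain g :: "nat \<Rightarrow> 'v" where "inj g"
    using assms(2) infinite_countable_subset by blast
  then have f: "inj (g \<circ> (to_nat :: node \<Rightarrow> nat))"
    by (simp add: inj_compose)
  note G = layered_hard_graph[OF assms(1) f]
  interpret hard_instance D "g \<circ> (to_nat :: node \<Rightarrow> nat)" MOO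
    using assms G f by unfold_locales
  show "\<exists>G :: 'v lgraph. layered_graph G D \<and> \<not> competitive MOO G \<rho>"
    using G not_competitive[OF \<rho>] by blast
qed

end
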